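(* Let $E$ be an infinite graph that satisfies the Wandering Condition: for all $\varepsilon>0$ there is $\delta>0$ such that, if $\gamma$ is a finite path (of length at least $1$) with $\gamma_1\notin F_\delta$, then $\gamma_{|\gamma|}\notin F_\varepsilon$. Let $(X,\sigma)$ be the Deaconu-Renault system associated with $E$. Then $(X,\sigma)$ has the shadowing property.
   Context: $\mathbb N=\{1,2,\ldots\}$. Graphs. A graph is $E=(E^0,E^1,r,s)$ with $E^0,E^1$ countable and $r,s:E^1\to E^0$; all graphs are assumed to have no sinks ($s^{-1}(v)\neq\emptyset$ for all $v\in E^0$). A finite path is a vertex (length $0$) or a sequence of edges $\alpha=\alpha_1\ldots\alpha_k$ with $r(\alpha_i)=s(\alpha_{i+1})$ for $1\le i<k$ (length $|\alpha|=k$); $\mathfrak p$ is the set of finite paths, including vertices, and $\mathfrak p^\infty$ the set of infinite paths $\gamma_1\gamma_2\ldots$ (with $r(\gamma_i)=s(\gamma_{i+1})$). One sets $r(v)=s(v)=v$ for vertices, $r(\alpha)=r(\alpha_{|\alpha|})$, $s(\alpha)=s(\alpha_1)$, $s(\gamma)\gamma=\gamma$, and $\gamma r(\gamma)=\gamma$ for finite $\gamma$. A finite path $\gamma$ is an initial segment of a path $\beta$ if $\beta=\gamma\gamma'$ for some path $\gamma'$ (so $s(\beta)$ is an initial segment of $\beta$). A vertex $v$ is an infinite emitter if $s^{-1}(v)$ is infinite. For a path $x$, $x_n$ is its $n$-th edge. The associated system. $X=\mathfrak p^\infty\cup X_{fin}$, where $X_{fin}=\{\alpha\in\mathfrak p: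 r(\alpha)\text{ is an infinite emitter}\}$. The map $\sigma$ has domain $\mathrm{Dom}(\sigma)=\{x\in X:|x|\ge1\}$ and deletes the first edge: $\sigma(\gamma_1\gamma_2\ldots)=\gamma_2\gamma_3\ldots$, $\sigma(\gamma_1\ldots\gamma_n)=\gamma_2\ldots\gamma_n$ for $n\ge2$, $\sigma(\gamma_1)=r(\gamma_1)$. Metric. Fix an enumeration $E^1=\{e_1,e_2,\ldots\}$ and an edge ordered enumeration $\mathfrak p=\{p_1,p_2,\ldots\}$, i.e. one such that for every $e_i$ the source of $e_i$ and all paths of length less than $i$ formed by edges $e_k$ with $k<i$ appear before $e_i$. For $x\ne y$ in $X$, $d(x,y)=1/2^i$ where $i$ is the smallest value such that $p_i$ is an initial segment of one of $x,y$ but not of the other; $d(x,x)=0$. For $\varepsilon>0$, $F_\varepsilon=\{e\in E^1: e=p_j \text{ for some } j\text{ with }1/2^j\ge\varepsilon\}$. Shadowing. A $\delta$-chain is an infinite sequence $(x_i)_{i=1}^\infty$ in $\mathrm{Dom}(\sigma)$ with $d(\sigma(x_i),x_{i+1})<\delta$ for all $i$. A point $x\in X$ $\varepsilon$-shadows $(y_i)_{i=1}^\infty$ if, for all $i$, $\sigma^{i-1}(x)$ is defined and $d(\sigma^{i-1}(x),y_i)<\varepsilon$. $(X,\sigma)$ has the shadowing property if for every $\varepsilon>0$ there is $\delta>0$ such that every $\delta$-chain is $\varepsilon$-shadowed by some $x\in X$. *)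

theory Defs
  imports Complex_Main "HOL-Library.Stream" "HOL-Library.Extended_Nat" "Graph_Theory.Arc_Walk"
begin

section \<open>Graphs and paths\<close>

text \<open>Here \<open>E\<^sup>0 = verts G\<close>, \<open>E\<^sup>1 = arcs G\<close>, \<open>s = tail G\<close> and \<open>r = head G\<close>.\<close>

locale sinkless_graph = wf_digraph +
  assumes countable_verts: "countable (verts G)"
    and countable_arcs: "countable (arcs G)"
    and no_sinks: "v \<in> verts G \<Longrightarrow> out_arcs G v \<noteq> {}"

text \<open>Without sinks, an infinite vertex set already forces the edge set to be infinite.\<close>

definition infinite_graph :: "('v, 'e) pre_digraph \<Rightarrow> bool" where
  "infinite_graph G \<longleftrightarrow> infinite (verts G) \<or> infinite (arcs G)"

definition infinite_emitter :: "('v, 'e) pre_digraph \<Rightarrow> 'v \<Rightarrow> bool" where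
  "infinite_emitter G v \<longleftrightarrow> v \<in> verts G \<and> infinite (out_arcs G v)"

text \<open>
  A finite path is stored together with its source, so that the vertex \<open>v\<close> is the path
  \<open>(v, [])\<close> and the edge \<open>e\<close> is the path \<open>(tail G e, [e])\<close>.
\<close>

type_synonym ('v, 'e) fpath = "'v \<times> 'e list"

datatype ('v, 'e) path = Fin "('v, 'e) fpath" | Inf "'e stream"

definition fin_paths :: "('v, 'e) pre_digraph \<Rightarrow> ('v, 'e) fpath set" where
  "fin_paths G = {(v, es). \<exists>w. pre_digraph.awalk G v es w}"

definition inf_paths :: "('v, 'e) pre_digraph \<Rightarrow> 'e stream set" where
  "inf_paths G = {\<gamma>. \<forall>n. \<gamma> !! n \<in> arcs G \<and> head G (\<gamma> !! n) = tail G (\<gamma> !! Suc n)}"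

definition all_paths :: "('v, 'e) pre_digraph \<Rightarrow> ('v, 'e) path set" where
  "all_paths G = Fin ` fin_paths G \<union> Inf ` inf_paths G"

fun path_source :: "('v, 'e) pre_digraph \<Rightarrow> ('v, 'e) path \<Rightarrow> 'v" where
  "path_source G (Fin (v, es)) = v"
| "path_source G (Inf \<gamma>) = tail G (shd \<gamma>)"

fun path_range :: "('v, 'e) pre_digraph \<Rightarrow> ('v, 'e) fpath \<Rightarrow> 'v" where
  "path_range G (v, es) = (if es = [] then v else head G (last es))"

fun path_length :: "('v, 'e) path \<Rightarrow> enat" where
  "path_length (Fin (v, es)) = enat (length es)"
| "path_length (Inf \<gamma>) = \<infinity>"

fun path_append :: "('v, 'e) fpath \<Rightarrow> ('v, 'e) path \<Rightarrow> ('v, 'e) path" where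
  "path_append (v, es) (Fin (w, fs)) = Fin (v, es @ fs)"
| "path_append (v, es) (Inf \<gamma>) = Inf (es @- \<gamma>)"

definition initial_segment ::
  "('v, 'e) pre_digraph \<Rightarrow> ('v, 'e) fpath \<Rightarrow> ('v, 'e) path \<Rightarrow> bool" where
  "initial_segment G \<gamma> \<beta> \<longleftrightarrow> \<gamma> \<in> fin_paths G \<and>
     (\<exists>\<gamma>' \<in> all_paths G. path_range G \<gamma> = path_source G \<gamma>' \<and> \<beta> = path_append \<gamma> \<gamma>')"

section \<open>The Deaconu-Renault system\<close>

definition path_space :: "('v, 'e) pre_digraph \<Rightarrow> ('v, 'e) path set" where
  "path_space G =
     Inf ` inf_paths G \<union> Fin ` {\<alpha> \<in> fin_paths G. infinite_emitter G (path_range G \<alpha>)}"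

definition shift_dom :: "('v, 'e) pre_digraph \<Rightarrow> ('v, 'e) path set" where
  "shift_dom G = {x \<in> path_space G. path_length x \<ge> 1}"

text \<open>The missing case \<open>Fin (v, [])\<close> lies outside \<open>shift_dom G\<close>; the value there is unspecified.\<close>

fun shift_map :: "('v, 'e) pre_digraph \<Rightarrow> ('v, 'e) path \<Rightarrow> ('v, 'e) path" where
  "shift_map G (Fin (v, e # es)) = Fin (head G e, es)"
| "shift_map G (Inf \<gamma>) = Inf (stl \<gamma>)"

section \<open>Enumerations and the metric\<close>

text \<open>
  Enumerations are indexed from 1 and without repetitions; their value at 0 is irrelevant.
\<close>

definition edge_enumeration :: "('v, 'e) pre_digraph \<Rightarrow> (nat \<Rightarrow> 'e) \<Rightarrow> bool" where
  "edge_enumeration G e \<longleftrightarrow> bij_betw e {1..} (arcs G)"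

definition appears_before :: "(nat \<Rightarrow> 'a) \<Rightarrow> 'a \<Rightarrow> 'a \<Rightarrow> bool" where
  "appears_before p a b \<longleftrightarrow> (\<exists>j k. 1 \<le> j \<and> j < k \<and> p j = a \<and> p k = b)"

text \<open>
  A path formed by edges \<open>e k\<close> with \<open>k < i\<close> has at least one edge: of the vertices, only the
  source of \<open>e i\<close> is required to precede \<open>e i\<close>.
\<close>

definition edge_ordered_enumeration ::
  "('v, 'e) pre_digraph \<Rightarrow> (nat \<Rightarrow> 'e) \<Rightarrow> (nat \<Rightarrow> ('v, 'e) fpath) \<Rightarrow> bool" where
  "edge_ordered_enumeration G e p \<longleftrightarrow>
     bij_betw p {1..} (fin_paths G) \<and>
     (\<forall>i\<ge>1. appears_before p (tail G (e i), []) (tail G (e i), [e i]) \<and>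
        (\<forall>(v, es) \<in> fin_paths G.
           es \<noteq> [] \<and> length es < i \<and> set es \<subseteq> e ` {1..<i} \<longrightarrow>
           appears_before p (v, es) (tail G (e i), [e i])))"

definition path_dist ::
  "('v, 'e) pre_digraph \<Rightarrow> (nat \<Rightarrow> ('v, 'e) fpath) \<Rightarrow>
    ('v, 'e) path \<Rightarrow> ('v, 'e) path \<Rightarrow> real" where
  "path_dist G p x y = (if x = y then 0 else
     1 / 2 ^ (LEAST i. 1 \<le> i \<and> initial_segment G (p i) x \<noteq> initial_segment G (p i) y))"

definition F_edges ::
  "('v, 'e) pre_digraph \<Rightarrow> (nat \<Rightarrow> ('v, 'e) fpath) \<Rightarrow> real \<Rightarrow> 'e set" where
  "F_edges G p \<epsilon> = {e \<in> arcs G. \<exists>j\<ge>1. p j = (tail G e, [e]) \<and> 1 / 2 ^ j \<ge> \<epsilon>}"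

definition wandering_condition ::
  "('v, 'e) pre_digraph \<Rightarrow> (nat \<Rightarrow> ('v, 'e) fpath) \<Rightarrow> bool" where
  "wandering_condition G p \<longleftrightarrow>
     (\<forall>\<epsilon>>0. \<exists>\<delta>>0. \<forall>(v, es) \<in> fin_paths G.
        length es \<ge> 1 \<and> hd es \<notin> F_edges G p \<delta> \<longrightarrow> last es \<notin> F_edges G p \<epsilon>)"

section \<open>Shadowing\<close>

text \<open>
  Throughout, \<open>f\<close> is a partial map on \<open>X\<close> with domain \<open>D\<close>, and sequences are indexed from 1.
\<close>

definition iterate_defined :: "'a set \<Rightarrow> ('a \<Rightarrow> 'a) \<Rightarrow> nat \<Rightarrow> 'a \<Rightarrow> bool" where
  "iterate_defined D f n x \<longleftrightarrow> (\<forall>k<n. (f ^^ k) x \<in> D)"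

definition delta_chain ::
  "'a set \<Rightarrow> ('a \<Rightarrow> 'a) \<Rightarrow> ('a \<Rightarrow> 'a \<Rightarrow> real) \<Rightarrow> real \<Rightarrow> (nat \<Rightarrow> 'a) \<Rightarrow> bool" where
  "delta_chain D f d \<delta> x \<longleftrightarrow> (\<forall>i\<ge>1. x i \<in> D \<and> d (f (x i)) (x (i + 1)) < \<delta>)"

definition shadows ::
  "'a set \<Rightarrow> ('a \<Rightarrow> 'a) \<Rightarrow> ('a \<Rightarrow> 'a \<Rightarrow> real) \<Rightarrow> real \<Rightarrow> 'a \<Rightarrow> (nat \<Rightarrow> 'a) \<Rightarrow> bool" where
  "shadows D f d \<epsilon> x y \<longleftrightarrow>
     (\<forall>i\<ge>1. iterate_defined D f (i - 1) x \<and> d ((f ^^ (i - 1)) x) (y i) < \<epsilon>)"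

definition shadowing_property ::
  "'a set \<Rightarrow> 'a set \<Rightarrow> ('a \<Rightarrow> 'a) \<Rightarrow> ('a \<Rightarrow> 'a \<Rightarrow> real) \<Rightarrow> bool" where
  "shadowing_property X D f d \<longleftrightarrow>
     (\<forall>\<epsilon>>0. \<exists>\<delta>>0. \<forall>y. delta_chain D f d \<delta> y \<longrightarrow> (\<exists>x\<in>X. shadows D f d \<epsilon> x y))"

end

theory Submission
  imports Defs
begin

text \<open>
  Closeness in \<open>X\<close> means agreement on finitely many initial segments. Given \<open>\<epsilon>\<close>, let \<open>A\<close> be the
  finite set of edges occurring in the relevant finite paths, together with one edge emitted by each
  of their sources, and let \<open>B\<close> be the set of edges from which \<open>A\<close> can be reached. The Wandering
  Condition says precisely that \<open>B\<close> is finite. If \<open>\<delta>\<close> is so small that the chain respects all short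
  paths over \<open>B\<close>, then the first edges \<open>a\<^sub>1, a\<^sub>2, \<dots>\<close> of the chain form a path as long as they
  lie in \<open>B\<close>, and once they leave \<open>B\<close> they never return. Any infinite path that follows the \<open>a\<^sub>i\<close> up to
  and including the first edge outside \<open>B\<close> shadows the chain, since beyond that edge neither side
  meets any of the relevant paths.
\<close>

text \<open>Only points of \<open>shift_dom G\<close> matter here; their edge list is nonempty, so
  \<open>hd []\<close> does not arise.\<close>

fun first_edge :: "('v, 'e) path \<Rightarrow> 'e" where
  "first_edge (Fin (v, es)) = hd es"
| "first_edge (Inf \<gamma>) = shd \<gamma>"

text \<open>A path of a single edge is allowed, so edges of \<open>A\<close> themselves count as
  reaching \<open>A\<close>.\<close>

definition edges_reaching :: "('v, 'e) pre_digraph \<Rightarrow> 'e set \<Rightarrow> 'e set" where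
  "edges_reaching G A = {a. \<exists>v es. (v, a # es) \<in> fin_paths G \<and> last (a # es) \<in> A}"

section \<open>Distance bounds and the finite sets \<open>F_edges\<close>\<close>

lemma path_dist_less_imp_agree:
  assumes "path_dist G p x y < 1 / 2 ^ N" "1 \<le> i" "i \<le> N"
  shows "initial_segment G (p i) x = initial_segment G (p i) y"
proof (rule ccontr)
  assume ne: "\<not> ?thesis"
  let ?P = "\<lambda>i. 1 \<le> i \<and> initial_segment G (p i) x \<noteq> initial_segment G (p i) y"
  have "(LEAST i. ?P i) \<le> N"
    using Least_le[of ?P i] ne assms by simp
  then have "(1::real) / 2 ^ N \<le> 1 / 2 ^ (LEAST i. ?P i)"
    by (intro divide_left_mono power_increasing) auto
  then show False
    using assms(1) ne unfolding path_dist_def by (cases "x = y") simp_all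
qed

text \<open>Taking \<delta> = 1/2^N works once N bounds the indices of the paths in
  \<open>Q\<close>. Members of \<open>Q\<close> that are not paths are initial segments of nothing,
  so \<open>Q\<close> may later be a full product of vertices and edge lists.\<close>

lemma path_dist_agreeD:
  fixes p :: "nat \<Rightarrow> ('v, 'e) fpath"
  assumes "bij_betw p {1..} (fin_paths G)" "finite Q"
  obtains \<delta> where "\<delta> > 0"
    "\<And>x y q. path_dist G p x y < \<delta> \<Longrightarrow> q \<in> Q \<Longrightarrow> initial_segment G q x = initial_segment G q y"
proof -
  have "Q \<inter> fin_paths G \<subseteq> p ` {1..}"
    using assms(1) by (auto simp: bij_betw_def)
  then obtain I where I: "I \<subseteq> {1..}" "finite I" "Q \<inter> fin_paths G = p ` I"
    using finite_subset_image[of "Q \<inter> fin_paths G" p "{1..}"] assms(2) by auto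
  obtain N where N: "I \<subseteq> {..N}"
    using I(2) finite_nat_iff_bounded_le by blast
  show ?thesis
  proof (rule that[of "1 / 2 ^ N"])
    fix x y q
    assume d: "path_dist G p x y < 1 / 2 ^ N" and "q \<in> Q"
    show "initial_segment G q x = initial_segment G q y"
    proof (cases "q \<in> fin_paths G")
      case True
      then obtain i where "i \<in> I" "q = p i"
        using I \<open>q \<in> Q\<close> by blast
      then show ?thesis
        using path_dist_less_imp_agree[OF d] I(1) N by auto
    qed (auto simp: initial_segment_def)
  qed simp
qed

text \<open>Only finitely many j satisfy 1/2^j \<ge> \<delta>, and \<open>p j\<close> determines the
  edge.\<close>

lemma finite_F_edges:
  assumes "\<delta> > 0"
  shows "finite (F_edges G p \<delta>)"
proof -
  obtain N where N: "(1 / 2 :: real) ^ N < \<delta>"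
    using real_arch_pow_inv[of \<delta> "1/2"] assms by auto
  have "F_edges G p \<delta> \<subseteq> (\<lambda>j. hd (snd (p j))) ` {..N}"
  proof
    fix a assume "a \<in> F_edges G p \<delta>"
    then obtain j where j: "p j = (tail G a, [a])" "\<delta> \<le> 1 / 2 ^ j"
      by (auto simp: F_edges_def)
    have "j \<le> N"
    proof (rule ccontr)
      assume "\<not> j \<le> N"
      then have "(1 / 2 :: real) ^ j \<le> (1 / 2) ^ N"
        by (intro power_decreasing) auto
      then show False using j N by (simp add: power_divide)
    qed
    then show "a \<in> (\<lambda>j. hd (snd (p j))) ` {..N}"
      using j(1) by (auto intro!: image_eqI[of _ _ j])
  qed
  then show ?thesis by (rule finite_subset) simp
qed

section \<open>Paths, the shift and initial segments\<close>

context sinkless_graph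
begin

lemma fin_paths_Nil [simp]: "(v, []) \<in> fin_paths G \<longleftrightarrow> v \<in> verts G"
  by (auto simp: fin_paths_def awalk_def)

lemma fin_paths_Cons [simp]:
  "(v, a # es) \<in> fin_paths G \<longleftrightarrow> a \<in> arcs G \<and> tail G a = v \<and> (head G a, es) \<in> fin_paths G"
  by (auto simp: fin_paths_def awalk_Cons_iff)

lemma fin_paths_verts: "(v, es) \<in> fin_paths G \<Longrightarrow> v \<in> verts G"
  by (auto simp: fin_paths_def awalk_def)

lemma fin_paths_arcs: "(v, es) \<in> fin_paths G \<Longrightarrow> set es \<subseteq> arcs G"
  by (auto simp: fin_paths_def awalk_def)

lemma path_space_subset: "path_space G \<subseteq> all_paths G"
  by (auto simp: path_space_def all_paths_def)

lemma path_source_in_verts: "x \<in> all_paths G \<Longrightarrow> path_source G x \<in> verts G"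
  by (auto simp: all_paths_def inf_paths_def fin_paths_verts)
     (metis snth.simps(1) tail_in_verts)

lemma shift_dom_cases:
  assumes "x \<in> shift_dom G"
  obtains v a es where "x = Fin (v, a # es)" "(v, a # es) \<in> fin_paths G"
    "infinite_emitter G (path_range G (v, a # es))"
  | \<gamma> where "x = Inf \<gamma>" "\<gamma> \<in> inf_paths G"
proof (cases x)
  case (Fin q)
  obtain v es where "q = (v, es)" by force
  then show ?thesis
    using assms that(1) Fin
    by (cases es) (auto simp: shift_dom_def path_space_def enat_0)
qed (use assms that in \<open>auto simp: shift_dom_def path_space_def\<close>)

lemma inf_paths_stl: "\<gamma> \<in> inf_paths G \<Longrightarrow> stl \<gamma> \<in> inf_paths G"
  unfolding inf_paths_def mem_Collect_eq by (metis snth.simps(2))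

lemma inf_paths_first:
  assumes "\<gamma> \<in> inf_paths G"
  shows "shd \<gamma> \<in> arcs G" "head G (shd \<gamma>) = tail G (shd (stl \<gamma>))"
  using assms[unfolded inf_paths_def mem_Collect_eq, rule_format, of 0] by auto

text \<open>Deleting the first edge keeps the range of a finite path, even when only a vertex
  remains.\<close>

lemma shift_map_in_path_space: "x \<in> shift_dom G \<Longrightarrow> shift_map G x \<in> path_space G"
  by (erule shift_dom_cases) (auto simp: path_space_def inf_paths_stl split: if_splits)

lemma first_edge_in_arcs: "x \<in> shift_dom G \<Longrightarrow> first_edge x \<in> arcs G"
  by (erule shift_dom_cases) (auto simp: inf_paths_first)

lemma path_source_first_edge: "x \<in> shift_dom G \<Longrightarrow> path_source G x = tail G (first_edge x)"
  by (erule shift_dom_cases) auto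

lemma path_source_shift_map:
  "x \<in> shift_dom G \<Longrightarrow> path_source G (shift_map G x) = head G (first_edge x)"
  by (erule shift_dom_cases) (auto simp: inf_paths_first)

lemma path_append_Nil: "path_source G x = v \<Longrightarrow> path_append (v, []) x = x"
  by (cases x) auto

lemma initial_segment_Nil:
  assumes "x \<in> all_paths G"
  shows "initial_segment G (v, []) x \<longleftrightarrow> path_source G x = v"
proof
  assume "initial_segment G (v, []) x"
  then show "path_source G x = v"
    by (auto simp: initial_segment_def path_append_Nil)
next
  assume "path_source G x = v"
  then show "initial_segment G (v, []) x"
    using assms path_source_in_verts[OF assms]
    by (auto simp: initial_segment_def path_append_Nil intro!: bexI[of _ x])
qed

text \<open>With \<open>initial_segment_Nil\<close> as base case, this recursion allows points to be
  compared edge by edge.\<close>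

lemma initial_segment_Cons:
  assumes x: "x \<in> shift_dom G"
  shows "initial_segment G (v, a # es) x \<longleftrightarrow>
    tail G a = v \<and> first_edge x = a \<and> initial_segment G (head G a, es) (shift_map G x)"
proof
  assume "initial_segment G (v, a # es) x"
  then obtain y where y: "(v, a # es) \<in> fin_paths G" "y \<in> all_paths G"
      "path_range G (v, a # es) = path_source G y" "x = path_append (v, a # es) y"
    by (auto simp: initial_segment_def)
  then have "first_edge x = a" "shift_map G x = path_append (head G a, es) y"
    by (cases y; auto)+
  then show "tail G a = v \<and> first_edge x = a \<and> initial_segment G (head G a, es) (shift_map G x)"
    using y by (auto simp: initial_segment_def split: if_splits)
next
  assume *: "tail G a = v \<and> first_edge x = a \<and> initial_segment G (head G a, es) (shift_map G x)"
  then obtain y where y: "(head G a, es) \<in> fin_paths G" "y \<in> all_paths G"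
      "path_range G (head G a, es) = path_source G y" "shift_map G x = path_append (head G a, es) y"
    by (auto simp: initial_segment_def)
  have "x = path_append (v, a # es) y"
    using x
  proof (cases rule: shift_dom_cases)
    case (1 w b fs)
    then show ?thesis using * y by (cases y) auto
  next
    case (2 \<gamma>)
    then show ?thesis using * y by (cases y) (auto, metis stream.collapse)
  qed
  moreover have "(v, a # es) \<in> fin_paths G"
    using * y(1) first_edge_in_arcs[OF x] by auto
  ultimately show "initial_segment G (v, a # es) x"
    using y by (auto simp: initial_segment_def split: if_splits)
qed

lemma Inf_in_shift_dom: "\<gamma> \<in> inf_paths G \<Longrightarrow> Inf \<gamma> \<in> shift_dom G"
  by (auto simp: shift_dom_def path_space_def)

lemma initial_segment_imp_stake:
  assumes "\<gamma> \<in> inf_paths G"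
  shows "initial_segment G (tail G (shd \<gamma>), stake n \<gamma>) (Inf \<gamma>)"
  using assms
proof (induction n arbitrary: \<gamma>)
  case 0
  then have "Inf \<gamma> \<in> all_paths G" by (simp add: all_paths_def)
  then show ?case by (simp add: initial_segment_Nil)
next
  case (Suc n)
  then show ?case
    using Suc.IH[OF inf_paths_stl]
    by (simp add: initial_segment_Cons Inf_in_shift_dom inf_paths_first)
qed

text \<open>A finite path is too short for all truncations of \<gamma>, and an infinite path with
  the same truncations has the same edges.\<close>

lemma eq_Inf_if_initial_segments:
  assumes "\<And>n. initial_segment G (tail G (shd \<gamma>), stake n \<gamma>) x"
  shows "x = Inf \<gamma>"
proof (cases x)
  case (Fin q)
  obtain w fs where q: "q = (w, fs)" by force
  obtain y where "Fin q = path_append (tail G (shd \<gamma>), stake (Suc (length fs)) \<gamma>) y"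
    using assms[of "Suc (length fs)"] unfolding Fin initial_segment_def by blast
  then have "\<exists>gs. fs = stake (Suc (length fs)) \<gamma> @ gs"
    unfolding q by (cases y) auto
  then show ?thesis
    by (metis length_append length_stake Suc_n_not_le_n le_add1)
next
  case (Inf \<gamma>')
  have "stake n \<gamma>' = stake n \<gamma>" for n
  proof -
    obtain y where "Inf \<gamma>' = path_append (tail G (shd \<gamma>), stake n \<gamma>) y"
      using assms[of n] unfolding Inf initial_segment_def by blast
    then obtain \<gamma>'' where "\<gamma>' = stake n \<gamma> @- \<gamma>''"
      by (cases y) auto
    then show ?thesis by (simp add: stake_shift)
  qed
  then have "\<gamma>' !! n = \<gamma> !! n" for n
    by (metis stake_nth lessI)
  then have "\<gamma>' = \<gamma>"
    using smap_alt[of id \<gamma>' \<gamma>] by (simp add: stream.map_id)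
  then show ?thesis using Inf by simp
qed

text \<open>Some truncation of \<gamma> separates it from any other \<open>y\<close>, so the
  \<open>LEAST\<close> in \<open>path_dist\<close> is attained; agreement on the first N paths
  pushes it beyond N.\<close>

lemma agree_imp_path_dist_less:
  fixes p :: "nat \<Rightarrow> ('a, 'b) fpath"
  assumes "bij_betw p {1..} (fin_paths G)" "\<epsilon> > 0"
  obtains Q where "finite Q" "Q \<subseteq> fin_paths G"
    "\<And>\<gamma> y. \<gamma> \<in> inf_paths G \<Longrightarrow>
      (\<And>q. q \<in> Q \<Longrightarrow> initial_segment G q (Inf \<gamma>) = initial_segment G q y) \<Longrightarrow>
      path_dist G p (Inf \<gamma>) y < \<epsilon>"
proof -
  obtain N where N: "(1 / 2 :: real) ^ N < \<epsilon>"
    using real_arch_pow_inv[of \<epsilon> "1/2"] assms by auto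
  show ?thesis
  proof (rule that[of "p ` {1..N}"])
    show "p ` {1..N} \<subseteq> fin_paths G"
      using assms(1) by (auto simp: bij_betw_def)
  next
    fix \<gamma> y
    assume \<gamma>: "\<gamma> \<in> inf_paths G"
      and agree: "\<And>q. q \<in> p ` {1..N} \<Longrightarrow> initial_segment G q (Inf \<gamma>) = initial_segment G q y"
    let ?P = "\<lambda>i. 1 \<le> i \<and> initial_segment G (p i) (Inf \<gamma>) \<noteq> initial_segment G (p i) y"
    show "path_dist G p (Inf \<gamma>) y < \<epsilon>"
    proof (cases "y = Inf \<gamma>")
      case False
      then obtain n where n: "\<not> initial_segment G (tail G (shd \<gamma>), stake n \<gamma>) y"
        using eq_Inf_if_initial_segments by blast
      have init: "initial_segment G (tail G (shd \<gamma>), stake n \<gamma>) (Inf \<gamma>)"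
        by (rule initial_segment_imp_stake[OF \<gamma>])
      then have "(tail G (shd \<gamma>), stake n \<gamma>) \<in> p ` {1..}"
        using assms(1) by (auto simp: bij_betw_def initial_segment_def)
      then have "\<exists>i. ?P i"
        using n init by force
      then have P: "?P (LEAST i. ?P i)"
        by (rule LeastI_ex)
      then have "N \<le> (LEAST i. ?P i)"
        using agree by (metis (lifting) atLeastAtMost_iff imageI nat_le_linear)
      then have "(1 / 2 :: real) ^ (LEAST i. ?P i) \<le> (1 / 2) ^ N"
        by (intro power_decreasing) auto
      then show ?thesis
        using False N by (auto simp: path_dist_def power_divide)
    qed (use assms in \<open>simp add: path_dist_def\<close>)
  qed simp
qed

section \<open>Edges from which a finite set can be reached\<close>

lemma edges_reaching_self: "A \<subseteq> arcs G \<Longrightarrow> A \<subseteq> edges_reaching G A"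
  by (force simp: edges_reaching_def)

lemma edges_reaching_backward:
  assumes "b \<in> edges_reaching G A" "a \<in> arcs G" "head G a = tail G b"
  shows "a \<in> edges_reaching G A"
proof -
  obtain v es where "(v, b # es) \<in> fin_paths G" "last (b # es) \<in> A"
    using assms(1) unfolding edges_reaching_def by blast
  then have "(tail G a, a # b # es) \<in> fin_paths G" "last (a # b # es) \<in> A"
    using assms by auto
  then show ?thesis unfolding edges_reaching_def by blast
qed

text \<open>Contrapositive of the Wandering Condition: a path ending in
  \<open>F_edges G p \<epsilon>\<close> starts in the finite set
  \<open>F_edges G p \<delta>\<close>.\<close>

lemma finite_edges_reaching:
  assumes bij: "bij_betw p {1..} (fin_paths G)" and wandering: "wandering_condition G p"
    and A: "finite A" "A \<subseteq> arcs G"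
  shows "finite (edges_reaching G A)"
proof -
  have "\<exists>\<epsilon>>0. A \<subseteq> F_edges G p \<epsilon>"
    using A
  proof (induction rule: finite_induct)
    case empty
    show ?case by (auto intro: exI[of _ 1])
  next
    case (insert a A)
    then obtain \<epsilon> where \<epsilon>: "\<epsilon> > 0" "A \<subseteq> F_edges G p \<epsilon>" by auto
    have "(tail G a, [a]) \<in> fin_paths G" using insert.prems by simp
    then obtain j where "j \<ge> 1" "p j = (tail G a, [a])"
      using bij unfolding bij_betw_def by (metis atLeast_iff imageE)
    \<comment> \<open>\<open>F_edges\<close> grows as its threshold shrinks, so the minimum keeps
      the old edges and admits \<open>a\<close>.\<close>
    then have "insert a A \<subseteq> F_edges G p (min \<epsilon> (1 / 2 ^ j))"
      using \<epsilon>(2) insert.prems by (fastforce simp: F_edges_def)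
    then show ?case using \<epsilon>(1) by (intro exI[of _ "min \<epsilon> (1 / 2 ^ j)"]) auto
  qed
  then obtain \<epsilon> where \<epsilon>: "\<epsilon> > 0" "A \<subseteq> F_edges G p \<epsilon>" by blast
  obtain \<delta> where "\<delta> > 0" and \<delta>: "\<forall>(v, es) \<in> fin_paths G.
      length es \<ge> 1 \<and> hd es \<notin> F_edges G p \<delta> \<longrightarrow> last es \<notin> F_edges G p \<epsilon>"
    using wandering \<epsilon>(1) unfolding wandering_condition_def by blast
  have "edges_reaching G A \<subseteq> F_edges G p \<delta>"
    using \<delta> \<epsilon>(2) unfolding edges_reaching_def by fastforce
  then show ?thesis
    using finite_F_edges[OF \<open>\<delta> > 0\<close>] finite_subset by blast
qed

section \<open>Construction of the shadowing path\<close>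

lemma funpow_shift_map_Inf: "(shift_map G ^^ n) (Inf \<gamma>) = Inf (sdrop n \<gamma>)"
  by (induction n arbitrary: \<gamma>) (auto simp: funpow_Suc_right simp del: funpow.simps)

lemma inf_paths_sdrop: "\<gamma> \<in> inf_paths G \<Longrightarrow> sdrop n \<gamma> \<in> inf_paths G"
  by (induction n arbitrary: \<gamma>) (auto simp: inf_paths_stl)

text \<open>The chain is reindexed from 0.\<close>

lemma shadowing_path_exists:
  fixes y :: "nat \<Rightarrow> ('a, 'b) path"
  assumes y: "\<And>n. y n \<in> shift_dom G"
    and B_backward: "\<And>a b. b \<in> B \<Longrightarrow> a \<in> arcs G \<Longrightarrow> head G a = tail G b \<Longrightarrow> a \<in> B"
    and V_emits: "\<And>v. v \<in> V \<Longrightarrow> \<exists>b\<in>B. tail G b = v"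
    and agree: "\<And>n v es. v \<in> V \<union> head G ` B \<union> tail G ` B \<Longrightarrow> set es \<subseteq> B \<Longrightarrow> length es \<le> L \<Longrightarrow>
      initial_segment G (v, es) (shift_map G (y n)) = initial_segment G (v, es) (y (Suc n))"
  obtains \<gamma> where "\<gamma> \<in> inf_paths G"
    "\<And>n v es. v \<in> V \<Longrightarrow> set es \<subseteq> B \<Longrightarrow> length es \<le> L \<Longrightarrow>
      initial_segment G (v, es) (Inf (sdrop n \<gamma>)) = initial_segment G (v, es) (y n)"
proof -
  define a where "a n = first_edge (y n)" for n
  have a_arcs: "a n \<in> arcs G" for n
    using y first_edge_in_arcs by (simp add: a_def)
  have y_all: "y n \<in> all_paths G" for n
    using y path_space_subset by (auto simp: shift_dom_def)
  \<comment> \<open>Agreement on the length-0 path at \<open>v\<close>; at vertices outside this set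
    the chain may jump.\<close>
  have joined: "head G (a n) = v \<longleftrightarrow> tail G (a (Suc n)) = v"
    if "v \<in> V \<union> head G ` B \<union> tail G ` B" for n v
    using agree[OF that, of "[]" n] y y_all shift_map_in_path_space[OF y] path_space_subset
    by (auto simp: a_def initial_segment_Nil path_source_shift_map path_source_first_edge subset_iff)
  have stays_out: "a n \<in> B" if "a (Suc n) \<in> B" for n
    using B_backward[OF that a_arcs] joined[of "tail G (a (Suc n))" n] that by blast

  \<comment> \<open>\<open>c\<close> copies the chain up to and including the first edge outside
    \<open>B\<close>, then continues arbitrarily, which is possible without sinks.\<close>
  define c where "c = rec_nat (a 0) (\<lambda>n b. if a n \<in> B then a (Suc n)
    else SOME b'. b' \<in> out_arcs G (head G b))"
  have c_0: "c 0 = a 0"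
    and c_Suc: "c (Suc n) = (if a n \<in> B then a (Suc n) else SOME b. b \<in> out_arcs G (head G (c n)))"
    for n
    by (simp_all add: c_def)
  have c_eq: "c n = a n" if "a n \<in> B" for n
    using that by (cases n) (auto simp: c_0 c_Suc stays_out)
  have some_out: "(SOME b. b \<in> out_arcs G v) \<in> out_arcs G v" if "v \<in> verts G" for v
    using no_sinks[OF that] by (meson someI_ex ex_in_conv)
  have c_arcs: "c n \<in> arcs G" for n
  proof (induction n)
    case (Suc n)
    then show ?case using a_arcs some_out[of "head G (c n)"] by (auto simp: c_Suc)
  qed (simp add: c_0 a_arcs)
  have c_joined: "head G (c n) = tail G (c (Suc n))" for n
  proof (cases "a n \<in> B")
    case True
    then show ?thesis using joined[of "head G (a n)" n] by (auto simp: c_eq c_Suc)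
  next
    case False
    then show ?thesis using some_out[of "head G (c n)"] c_arcs[of n] by (auto simp: c_Suc)
  qed
  \<comment> \<open>After the exit, backward closure of \<open>B\<close> keeps the arbitrary
    continuation outside as well.\<close>
  have c_out: "c n \<notin> B" if "a n \<notin> B" for n
    using that
  proof (induction n)
    case (Suc n)
    then show ?case
      using B_backward[of "c (Suc n)" "c n"] c_arcs[of n] c_joined[of n] c_Suc[of n] by metis
  qed (simp add: c_0)

  \<comment> \<open>After the exit the sources may differ, but neither is \<open>v\<close>: since
    \<open>v\<close> emits an edge of \<open>B\<close>, any edge ending at \<open>v\<close> would
    lie in \<open>B\<close>.\<close>
  have tails: "tail G (c n) = v \<longleftrightarrow> tail G (a n) = v" if v: "v \<in> V" for n v
  proof (cases n)
    case (Suc m)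
    show ?thesis
    proof (cases "a m \<in> B")
      case True
      then show ?thesis by (simp add: Suc c_Suc)
    next
      case False
      obtain b where b: "b \<in> B" "tail G b = v" using V_emits v by blast
      have "head G (a m) \<noteq> v" "head G (c m) \<noteq> v"
        using b False c_out B_backward[OF b(1)] a_arcs c_arcs by auto
      then show ?thesis
        using joined[of v m] v c_joined[of m] Suc by auto
    qed
  qed (simp add: c_0)

  define \<gamma> where "\<gamma> = smap c (fromN 0)"
  have \<gamma>_nth: "\<gamma> !! n = c n" for n
    by (simp add: \<gamma>_def)
  have \<gamma>: "\<gamma> \<in> inf_paths G"
    using c_arcs c_joined by (simp add: inf_paths_def \<gamma>_nth del: snth.simps)
  have \<gamma>_all: "Inf (sdrop n \<gamma>) \<in> all_paths G" for n
    using inf_paths_sdrop[OF \<gamma>] by (auto simp: all_paths_def)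
  \<comment> \<open>The induction moves on to \<open>head G b\<close>, possibly outside
    \<open>V\<close>, so \<open>v \<in> V\<close> is weakened to agreement of sources at
    \<open>v\<close>.\<close>
  have "initial_segment G (v, es) (Inf (sdrop n \<gamma>)) = initial_segment G (v, es) (y n)"
    if "tail G (c n) = v \<longleftrightarrow> tail G (a n) = v" "set es \<subseteq> B" "length es \<le> L" for n v es
    using that
  proof (induction es arbitrary: n v)
    case Nil
    then show ?case
      using y_all \<gamma>_all y by (simp add: initial_segment_Nil path_source_first_edge a_def \<gamma>_nth)
  next
    case (Cons b es)
    \<comment> \<open>Here \<open>b\<close> lies in \<open>B\<close>: inside \<open>B\<close> the
      two edges coincide, and otherwise both lie outside.\<close>
    have eq: "c n = b \<longleftrightarrow> a n = b"
      using Cons.prems(2) c_eq[of n] c_out[of n] by (metis list.set_intros(1) subsetD)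
    have "initial_segment G (head G b, es) (Inf (sdrop (Suc n) \<gamma>))
        = initial_segment G (head G b, es) (shift_map G (y n))" if b: "a n = b"
    proof -
      have "c (Suc n) = a (Suc n)" using b Cons.prems by (simp add: c_Suc)
      then show ?thesis
        using Cons.IH[of "Suc n" "head G b"] agree[of "head G b" es n] Cons.prems by auto
    qed
    moreover have "initial_segment G (v, b # es) (Inf (sdrop n \<gamma>)) \<longleftrightarrow>
        tail G b = v \<and> c n = b \<and> initial_segment G (head G b, es) (Inf (sdrop (Suc n) \<gamma>))"
      by (simp add: initial_segment_Cons Inf_in_shift_dom inf_paths_sdrop \<gamma> \<gamma>_nth)
    moreover have "initial_segment G (v, b # es) (y n) \<longleftrightarrow>
        tail G b = v \<and> a n = b \<and> initial_segment G (head G b, es) (shift_map G (y n))"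
      by (simp add: initial_segment_Cons y a_def)
    ultimately show ?case
      using eq by blast
  qed
  then show ?thesis
    using that[OF \<gamma>] tails by simp
qed

text \<open>The choices depend on each other in this order: \<epsilon>, \<open>Q\<close>, then
  \<open>V\<close>, \<open>A\<close>, \<open>B\<close> and \<open>L\<close>, and finally
  \<delta>.\<close>

lemma shadowing_property_if_wandering:
  assumes bij: "bij_betw p {1..} (fin_paths G)" and wandering: "wandering_condition G p"
  shows "shadowing_property (path_space G) (shift_dom G) (shift_map G) (path_dist G p)"
  unfolding shadowing_property_def
proof (intro allI impI)
  fix \<epsilon> :: real
  assume "\<epsilon> > 0"
  then obtain Q where Q: "finite Q" "Q \<subseteq> fin_paths G"
    and close: "\<And>\<gamma> x. \<gamma> \<in> inf_paths G \<Longrightarrow>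
      (\<And>q. q \<in> Q \<Longrightarrow> initial_segment G q (Inf \<gamma>) = initial_segment G q x) \<Longrightarrow>
      path_dist G p (Inf \<gamma>) x < \<epsilon>"
    using agree_imp_path_dist_less[OF bij] by metis
  define V where "V = fst ` Q"
  have V: "finite V" "V \<subseteq> verts G"
    using Q fin_paths_verts by (auto simp: V_def)
  have "\<forall>v\<in>V. \<exists>b. b \<in> out_arcs G v" using V no_sinks by fast
  \<comment> \<open>These edges enter \<open>A\<close> so that every vertex of \<open>V\<close>
    emits an edge of \<open>B\<close>.\<close>
  then obtain f where f: "\<And>v. v \<in> V \<Longrightarrow> f v \<in> out_arcs G v" by metis
  define A where "A = (\<Union>q\<in>Q. set (snd q)) \<union> f ` V"
  have A: "finite A" "A \<subseteq> arcs G"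
    using Q V f fin_paths_arcs by (fastforce simp: A_def)+
  define B where "B = edges_reaching G A"
  have "finite B"
    using finite_edges_reaching[OF bij wandering A] by (simp add: B_def)
  have "A \<subseteq> B"
    using edges_reaching_self[OF A(2)] by (simp add: B_def)
  obtain L where L: "\<And>q. q \<in> Q \<Longrightarrow> length (snd q) \<le> L"
    using Q(1) finite_nat_set_iff_bounded_le[of "(\<lambda>q. length (snd q)) ` Q"] by auto
  \<comment> \<open>Heads of \<open>B\<close> make the chain join up within \<open>B\<close>; tails
    prevent its return. Finiteness of \<open>B\<close> makes \<open>?R\<close> finite.\<close>
  let ?R = "(V \<union> head G ` B \<union> tail G ` B) \<times> {es. set es \<subseteq> B \<and> length es \<le> L}"
  have "finite ?R"
    using V(1) \<open>finite B\<close> by (simp add: finite_lists_length_le)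
  obtain \<delta> where "\<delta> > 0" and \<delta>: "\<And>x y q. path_dist G p x y < \<delta> \<Longrightarrow> q \<in> ?R \<Longrightarrow>
      initial_segment G q x = initial_segment G q y"
    by (rule path_dist_agreeD[OF bij \<open>finite ?R\<close>]) blast
  show "\<exists>\<delta>>0. \<forall>y. delta_chain (shift_dom G) (shift_map G) (path_dist G p) \<delta> y \<longrightarrow>
      (\<exists>x\<in>path_space G. shadows (shift_dom G) (shift_map G) (path_dist G p) \<epsilon> x y)"
  proof (intro exI[of _ \<delta>] conjI allI impI)
    fix y
    assume chain: "delta_chain (shift_dom G) (shift_map G) (path_dist G p) \<delta> y"
    obtain \<gamma> where \<gamma>: "\<gamma> \<in> inf_paths G"
      and agree: "\<And>n v es. v \<in> V \<Longrightarrow> set es \<subseteq> B \<Longrightarrow> length es \<le> L \<Longrightarrow>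
        initial_segment G (v, es) (Inf (sdrop n \<gamma>)) = initial_segment G (v, es) (y (Suc n))"
    proof (rule shadowing_path_exists[of "\<lambda>n. y (Suc n)" B V L])
      show "y (Suc n) \<in> shift_dom G" for n
        using chain by (simp add: delta_chain_def)
      show "a \<in> B" if "b \<in> B" "a \<in> arcs G" "head G a = tail G b" for a b
        using that edges_reaching_backward by (simp add: B_def)
      show "\<exists>b\<in>B. tail G b = v" if "v \<in> V" for v
        using f[OF that] that \<open>A \<subseteq> B\<close> by (auto simp: A_def)
      show "initial_segment G (v, es) (shift_map G (y (Suc n)))
          = initial_segment G (v, es) (y (Suc (Suc n)))"
        if "v \<in> V \<union> head G ` B \<union> tail G ` B" "set es \<subseteq> B" "length es \<le> L" for n v es
        using chain that by (intro \<delta>) (auto simp: delta_chain_def)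
    qed blast
    have dom: "(shift_map G ^^ n) (Inf \<gamma>) \<in> shift_dom G" for n
      using Inf_in_shift_dom[OF inf_paths_sdrop[OF \<gamma>]] by (simp add: funpow_shift_map_Inf)
    have "path_dist G p ((shift_map G ^^ n) (Inf \<gamma>)) (y (Suc n)) < \<epsilon>" for n
      unfolding funpow_shift_map_Inf
    proof (rule close[OF inf_paths_sdrop[OF \<gamma>]])
      fix q assume q: "q \<in> Q"
      then have "fst q \<in> V" "set (snd q) \<subseteq> B"
        using \<open>A \<subseteq> B\<close> by (auto simp: V_def A_def)
      then show "initial_segment G q (Inf (sdrop n \<gamma>)) = initial_segment G q (y (Suc n))"
        using agree[of "fst q" "snd q" n] L[OF q] by simp
    qed
    \<comment> \<open>The index i \<ge> 1 in \<open>shadows\<close> corresponds to n = i -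
      1.\<close>
    then have "shadows (shift_dom G) (shift_map G) (path_dist G p) \<epsilon> (Inf \<gamma>) y"
      unfolding shadows_def iterate_defined_def using dom
      by (metis One_nat_def Suc_diff_le diff_Suc_Suc diff_zero)
    then show "\<exists>x\<in>path_space G. shadows (shift_dom G) (shift_map G) (path_dist G p) \<epsilon> x y"
      using \<gamma> by (auto simp: path_space_def)
  qed (rule \<open>\<delta> > 0\<close>)
qed

end

theorem proposition5p5:
  fixes G :: "('v, 'e) pre_digraph"
    and e :: "nat \<Rightarrow> 'e"
    and p :: "nat \<Rightarrow> ('v, 'e) fpath"
  assumes "sinkless_graph G"
    and "infinite_graph G"
    and "edge_enumeration G e"
    and "edge_ordered_enumeration G e p"
    and "wandering_condition G p"
  shows "shadowing_property (path_space G) (shift_dom G) (shift_map G) (path_dist G p)"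
  using assms sinkless_graph.shadowing_property_if_wandering
  unfolding edge_ordered_enumeration_def by blast

end
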